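(* Let $\mathbb X$ be a complete separable metric space with Borel $\sigma$-field $\mathcal X$. Let $\eta=\sum_{i=1}^{\tau}\delta_{X_i}$ be a mixed sampled point process on $\mathbb X$ for which $\tau\in\mathcal S$. Then $\eta$ is negatively associated (NA).
   Context: Mixed sampled point process: $(X_i)_{i\ge1}$ is an i.i.d. sequence of random elements of $\mathbb X$ with common distribution $F$, $\tau$ is a random variable with values in $\{0,1,2,\dots\}$ independent of $(X_i)_{i\ge 1}$, and $\eta=\sum_{i=1}^{\tau}\delta_{X_i}$, where $\delta_x$ is the Dirac measure at $x$. Class $\mathcal S$: a finite sequence $(a_i)_{i=0}^n$ of non-negative reals with no internal zeros (the indices of its non-zero terms form a discrete interval) is ultra log-concave, ULC$(n)$, if $\left(a_i/\binom ni\right)^2\ge \frac{a_{i-1}}{\binom n{i-1}}\cdot\frac{a_{i+1}}{\binom n{i+1}}$ for $i=1,\dots,n-1$. $\mathcal S_n$ is the class of (distributions of) random variables $\tau$ with values in $\{0,\dots,n\}$ such that $(\mathbb P(\tau=i))_{i=0}^n$ is ULC$(n)$. $\mathcal S$ is the weak closure of $\bigcup_{n\ge1}\mathcal S_n$, i.e. the class of all probability distributions on $\{0,1,2,\dots\}$ that are weak limits of distributions from $\bigcup_n\mathcal S_n$. One writes $\tau\in\mathcal S$ if the distribution of $\tau$ belongs to $\mathcal S$. NA: a random vector $(Y_1,\dots,Y_n)$ is NA if for every $A\subseteq\{1,\dots,n\}$, $\mathrm{Cov}\big(f(Y_i,i\in A),g(Y_j,j\in A^c)\big)\le 0$ for all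 real functions $f,g$ that are non-decreasing (coordinatewise) and for which the covariance exists. A point process $\eta$ on $\mathbb X$ is NA if for every finite collection of disjoint sets $B_1,\dots,B_n\in\mathcal X$ the vector $(\eta(B_1),\dots,\eta(B_n))$ is NA. *)

theory Defs
  imports "HOL-Probability.Probability"
begin

definition ULC :: "nat \<Rightarrow> (nat \<Rightarrow> real) \<Rightarrow> bool" where
  "ULC n a \<longleftrightarrow>
     (\<forall>i\<le>n. 0 \<le> a i) \<and>
     (\<forall>i j k. i < j \<and> j < k \<and> k \<le> n \<and> a i \<noteq> 0 \<and> a k \<noteq> 0 \<longrightarrow> a j \<noteq> 0) \<and>
     (\<forall>i\<in>{1..<n}. (a i / real (n choose i))\<^sup>2 \<ge>
        (a (i - 1) / real (n choose (i - 1))) * (a (i + 1) / real (n choose (i + 1))))"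

definition nat_laws :: "nat measure set" where
  "nat_laws = {\<mu>. prob_space \<mu> \<and> sets \<mu> = sets (count_space UNIV)}"

definition ULC_laws :: "nat \<Rightarrow> nat measure set" where
  "ULC_laws n = {\<mu> \<in> nat_laws. measure \<mu> {..n} = 1 \<and> ULC n (\<lambda>i. measure \<mu> {i})}"

text \<open>The library states weak convergence for laws on the real line, so laws on the natural
  numbers are pushed forward along the embedding. Weak convergence of probability laws on the
  line is metrizable, so sequential limits give the whole weak closure.\<close>

definition class_S :: "nat measure set" where
  "class_S = {\<mu> \<in> nat_laws. \<exists>\<nu>. (\<forall>k. \<nu> k \<in> (\<Union>n\<in>{1..}. ULC_laws n)) \<and>
      weak_conv_m (\<lambda>k. distr (\<nu> k) borel real) (distr \<mu> borel real)}"

text \<open>Independence of two random elements with values in different types; the library's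
  \<open>indep_var\<close> needs a common type. The right-hand side is that of \<open>prob_space.indep_var_eq\<close>.\<close>

definition (in prob_space) indep_elements ::
    "'b measure \<Rightarrow> ('a \<Rightarrow> 'b) \<Rightarrow> 'c measure \<Rightarrow> ('a \<Rightarrow> 'c) \<Rightarrow> bool" where
  "indep_elements S X T Y \<longleftrightarrow>
     random_variable S X \<and> random_variable T Y \<and>
     indep_set
       (sigma_sets (space M) {X -` A \<inter> space M | A. A \<in> sets S})
       (sigma_sets (space M) {Y -` A \<inter> space M | A. A \<in> sets T})"

definition sampled_process ::
    "('w \<Rightarrow> nat) \<Rightarrow> (nat \<Rightarrow> 'w \<Rightarrow> 'x::topological_space) \<Rightarrow> 'w \<Rightarrow> 'x measure" where
  "sampled_process \<tau> X \<omega> =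
     measure_of UNIV (sets borel) (\<lambda>B. \<Sum>i\<in>{1..\<tau> \<omega>}. emeasure (return borel (X i \<omega>)) B)"

lemma space_sampled_process [simp]: "space (sampled_process \<tau> X \<omega>) = UNIV"
  by (simp add: sampled_process_def space_measure_of_conv)

lemma sets_sampled_process [simp, measurable_cong]:
  "sets (sampled_process \<tau> X \<omega>) = sets borel"
  by (metis sampled_process_def sets.sets_measure_of_eq space_borel)

text \<open>The set function above is countably additive, so \<open>measure_of\<close> does return it.\<close>

lemma emeasure_sampled_process:
  fixes X :: "nat \<Rightarrow> 'w \<Rightarrow> 'x::topological_space"
  assumes "B \<in> sets borel"
  shows "emeasure (sampled_process \<tau> X \<omega>) B =
    (\<Sum>i\<in>{1..\<tau> \<omega>}. emeasure (return borel (X i \<omega>)) B)"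
proof (rule emeasure_measure_of[OF sampled_process_def])
  show "countably_additive (sets (sampled_process \<tau> X \<omega>))
      (\<lambda>B. \<Sum>i\<in>{1..\<tau> \<omega>}. emeasure (return borel (X i \<omega>)) B)"
  proof (rule countably_additiveI)
    fix A :: "nat \<Rightarrow> 'x set"
    assume A: "range A \<subseteq> sets (sampled_process \<tau> X \<omega>)" "disjoint_family A"
    have "(\<Sum>k. \<Sum>i\<in>{1..\<tau> \<omega>}. emeasure (return borel (X i \<omega>)) (A k)) =
        (\<Sum>i\<in>{1..\<tau> \<omega>}. \<Sum>k. emeasure (return borel (X i \<omega>)) (A k))"
      by (intro suminf_sum) auto
    also have "\<dots> = (\<Sum>i\<in>{1..\<tau> \<omega>}. emeasure (return borel (X i \<omega>)) (\<Union>k. A k))"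
      using A by (intro sum.cong refl suminf_emeasure) auto
    finally show "(\<Sum>k. \<Sum>i\<in>{1..\<tau> \<omega>}. emeasure (return borel (X i \<omega>)) (A k)) =
        (\<Sum>i\<in>{1..\<tau> \<omega>}. emeasure (return borel (X i \<omega>)) (\<Union>k. A k))" .
  qed
qed (use assms in \<open>auto simp: positive_def\<close>)

definition (in prob_space) covariance :: "('a \<Rightarrow> real) \<Rightarrow> ('a \<Rightarrow> real) \<Rightarrow> real" where
  "covariance U V =
     expectation (\<lambda>\<omega>. (U \<omega> - expectation U) * (V \<omega> - expectation V))"

definition (in prob_space) covariance_exists :: "('a \<Rightarrow> real) \<Rightarrow> ('a \<Rightarrow> real) \<Rightarrow> bool" where
  "covariance_exists U V \<longleftrightarrow>
     integrable M U \<and> integrable M V \<and> integrable M (\<lambda>\<omega>. U \<omega> * V \<omega>)"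

text \<open>A real function of the coordinates in \<open>A\<close> is a function on \<open>A \<rightarrow>\<^sub>E UNIV\<close>, where
  the pointwise order of functions is the coordinatewise order.\<close>

definition (in prob_space) NA_vector :: "nat \<Rightarrow> (nat \<Rightarrow> 'a \<Rightarrow> real) \<Rightarrow> bool" where
  "NA_vector n Y \<longleftrightarrow>
     (\<forall>i\<in>{1..n}. random_variable borel (Y i)) \<and>
     (\<forall>A\<subseteq>{1..n}. \<forall>f g :: (nat \<Rightarrow> real) \<Rightarrow> real.
        mono_on (A \<rightarrow>\<^sub>E UNIV) f \<longrightarrow>
        mono_on (({1..n} - A) \<rightarrow>\<^sub>E UNIV) g \<longrightarrow>
        covariance_exists (\<lambda>\<omega>. f (\<lambda>i\<in>A. Y i \<omega>)) (\<lambda>\<omega>. g (\<lambda>j\<in>{1..n} - A. Y j \<omega>)) \<longrightarrow>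
        covariance (\<lambda>\<omega>. f (\<lambda>i\<in>A. Y i \<omega>)) (\<lambda>\<omega>. g (\<lambda>j\<in>{1..n} - A. Y j \<omega>)) \<le> 0)"

text \<open>Intended for processes with almost surely finitely many points, since \<open>measure\<close> sends
  an infinite mass to \<open>0\<close>.\<close>

definition (in prob_space) NA_process :: "('a \<Rightarrow> 'x::topological_space measure) \<Rightarrow> bool" where
  "NA_process \<eta> \<longleftrightarrow>
     (\<forall>n. \<forall>B :: nat \<Rightarrow> 'x set.
        (\<forall>i\<in>{1..n}. B i \<in> sets borel) \<and> disjoint_family_on B {1..n} \<longrightarrow>
        NA_vector n (\<lambda>i \<omega>. measure (\<eta> \<omega>) (B i)))"

end

theory Submission
  imports Defs
begin

text \<open>Write \<open>c k\<close> for the probability that \<open>\<tau> = k\<close>. The class \<open>S\<close> enters through the fact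
  that \<open>k! * c k\<close> is log-concave. A ULC law has it, because
  \<open>k! * (n choose k) = n! / (n - k)!\<close> and the sequence \<open>1 / (n - k)!\<close> is itself log-concave in
  \<open>k\<close>; in the form of a four-point inequality it survives pointwise limits, hence weak limits
  (\<open>class_S_log_concave\<close>).

  Let \<open>U\<close> be the union of the sets that the first function \<open>f\<close> looks at, and \<open>V\<close> its complement, which
  contains the sets that the second function \<open>g\<close> looks at. Given that \<open>s\<close> points fall in \<open>U\<close> and \<open>t\<close> in
  \<open>V\<close>, the values of \<open>f\<close> and \<open>g\<close> are independent, the mean of \<open>f\<close> depends on \<open>s\<close> only and the mean
  of \<open>g\<close> on \<open>t\<close> only, and both are nondecreasing since one more point can only increase a
  nondecreasing function. So it is enough to treat the two numbers of points in \<open>U\<close> and \<open>V\<close>. With \<open>p\<close> and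
  \<open>q\<close> the masses of \<open>U\<close> and \<open>V\<close>, they take the values \<open>s\<close> and \<open>t\<close> with probability
  \<open>c (s + t) * (s + t choose s) * p ^ s * q ^ t\<close>, that is
  \<open>((s + t)! * c (s + t)) * (p ^ s / s!) * (q ^ t / t!)\<close>. Log-concavity of the first
  factor makes this reverse regular of order two: for \<open>s \<le> s'\<close> and \<open>t \<le> t'\<close> the weight of
  \<open>(s, t)\<close> times that of \<open>(s', t')\<close> is at most the weight of \<open>(s, t')\<close> times that of
  \<open>(s', t)\<close>. Under such weights a nondecreasing function of \<open>s\<close> and one of \<open>t\<close> are
  negatively correlated (\<open>rr2_sum_mult_le\<close>, \<open>binomial_mix_mult_le\<close>).

  Conditional means are avoided: \<open>count_mean\<close> gives the expectations over a fixed number of points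
  as finite sums, restricted to the points with labels in a given set, and \<open>count_mean_mult\<close> splits
  the points between \<open>U\<close> and \<open>V\<close>. The correlation inequality is then one between finite sums for
  \<open>\<tau>\<close> truncated at \<open>K\<close>, and it passes to the limit in \<open>K\<close> by dominated convergence
  (\<open>count_mean_sums_expectation\<close>).\<close>

section \<open>Log-concave sequences and the class of counting laws\<close>

text \<open>The four-point form, unlike the inequality between neighbours, excludes internal zeros by
  itself, so that it passes to pointwise limits without a separate condition on the support.\<close>

definition log_concave_seq :: "(nat \<Rightarrow> real) \<Rightarrow> bool" where
  "log_concave_seq b \<longleftrightarrow>
     (\<forall>k. 0 \<le> b k) \<and> (\<forall>x m n. b x * b (x + m + n) \<le> b (x + m) * b (x + n))"

text \<open>On the support, the inequality between neighbours says that the ratios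
  \<open>b (i + 1) / b i\<close> decrease. Comparing one ratio with a later one, and then multiplying \<open>m\<close> such
  comparisons, gives the four-point inequality.\<close>

lemma log_concave_seqI:
  fixes b :: "nat \<Rightarrow> real"
  assumes nonneg: "\<And>k. 0 \<le> b k"
    and no_gap: "\<And>i j k. i < j \<Longrightarrow> j < k \<Longrightarrow> b i \<noteq> 0 \<Longrightarrow> b k \<noteq> 0 \<Longrightarrow> b j \<noteq> 0"
    and local: "\<And>i. b i * b (i + 2) \<le> (b (i + 1))\<^sup>2"
  shows "log_concave_seq b"
proof -
  have pos: "0 < b j" if "b i \<noteq> 0" "b k \<noteq> 0" "i \<le> j" "j \<le> k" for i j k
    using that no_gap[of i j k] nonneg[of j] by (metis le_neq_implies_less less_eq_real_def)
  have step: "b x * b (x + n + 1) \<le> b (x + 1) * b (x + n)" for x n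
  proof (induction n)
    case (Suc n)
    show ?case
    proof (cases "b x = 0 \<or> b (x + Suc n + 1) = 0")
      case True
      then show ?thesis using nonneg by auto
    next
      case False
      then have p: "0 < b (x + n)" "0 < b (x + n + 1)" "0 < b x"
        using pos[of x "x + Suc n + 1"] by auto
      have "(b x * b (x + n + 2)) * b (x + n) \<le> b x * (b (x + n + 1))\<^sup>2"
        using mult_left_mono[OF local[of "x + n"] nonneg[of x]] by (simp add: algebra_simps)
      also have "\<dots> \<le> (b (x + 1) * b (x + n)) * b (x + n + 1)"
        using mult_right_mono[OF Suc.IH, of "b (x + n + 1)"] p
        by (simp add: power2_eq_square algebra_simps)
      finally show ?thesis using p by (simp add: algebra_simps)
    qed
  qed simp
  have "b x * b (x + m + n) \<le> b (x + m) * b (x + n)" for x m n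
  proof (induction m)
    case (Suc m)
    show ?case
    proof (cases "b x = 0 \<or> b (x + Suc m + n) = 0")
      case True
      then show ?thesis using nonneg by auto
    next
      case False
      then have p: "0 < b (x + m)" "0 < b (x + m + n)"
        using pos[of x "x + Suc m + n"] by auto
      have "(b x * b (x + m + n)) * (b (x + m) * b (x + m + n + 1))
          \<le> (b (x + m) * b (x + n)) * (b (x + m + 1) * b (x + m + n))"
        by (rule mult_mono[OF Suc.IH step[of "x + m" n]]) (use nonneg in simp_all)
      then have "(b x * b (x + m + n + 1)) * (b (x + m) * b (x + m + n))
          \<le> (b (x + m + 1) * b (x + n)) * (b (x + m) * b (x + m + n))"
        by (simp add: mult_ac)
      then have "b x * b (x + m + n + 1) \<le> b (x + m + 1) * b (x + n)"
        using p by (metis mult_le_cancel_right_pos mult_pos_pos)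
      then show ?thesis by (simp add: add_ac)
    qed
  qed simp
  with nonneg show ?thesis by (simp add: log_concave_seq_def)
qed

lemma log_concave_seq_limit:
  assumes "\<And>k. log_concave_seq (b k)" and lim: "\<And>i. (\<lambda>k. b k i) \<longlonglongrightarrow> c i"
  shows "log_concave_seq c"
  unfolding log_concave_seq_def
proof (intro conjI allI)
  show "0 \<le> c i" for i
    using assms(1) by (intro LIMSEQ_le_const[OF lim]) (auto simp: log_concave_seq_def)
  show "c x * c (x + m + n) \<le> c (x + m) * c (x + n)" for x m n
    using assms(1)
    by (intro LIMSEQ_le[OF tendsto_mult[OF lim lim] tendsto_mult[OF lim lim]])
      (auto simp: log_concave_seq_def)
qed

text \<open>With \<open>b k = k! * a k\<close> one has \<open>a k / (n choose k) = b k * (n - k)! / n!\<close>. The ULC inequality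
  thus bounds \<open>b i * b (i + 2)\<close> with the factor \<open>(m + 2)! * m!\<close> by \<open>b (i + 1)\<^sup>2\<close> with the
  smaller factor \<open>((m + 1)!)\<^sup>2\<close>, where \<open>m = n - i - 2\<close>.\<close>

lemma ULC_law_log_concave:
  assumes "\<nu> \<in> ULC_laws n"
  shows "log_concave_seq (\<lambda>k. fact k * measure \<nu> {k})"
proof -
  interpret prob_space \<nu> using assms by (simp add: ULC_laws_def nat_laws_def)
  have sets [simp]: "sets \<nu> = UNIV" and full: "prob {..n} = 1"
    and ulc: "ULC n (\<lambda>i. prob {i})"
    using assms by (auto simp: ULC_laws_def nat_laws_def)
  have out: "prob {i} = 0" if "n < i" for i
  proof -
    have "prob ({..n} \<union> {i}) = prob {..n} + prob {i}"
      using that by (intro finite_measure_Union) auto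
    with full prob_le_1[of "{..n} \<union> {i}"] measure_nonneg[of \<nu> "{i}"] show ?thesis by linarith
  qed
  have local: "fact i * prob {i} * (fact (i + 2) * prob {i + 2}) \<le> (fact (i + 1) * prob {i + 1})\<^sup>2"
    for i
  proof (cases "i + 2 \<le> n")
    case True
    define m where "m = n - i - 2"
    have n: "n = i + m + 2" using True by (simp add: m_def)
    let ?b = "\<lambda>j. fact j * prob {j}"
    have quot: "prob {j} / real (n choose j) = ?b j * fact (n - j) / fact n" if "j \<le> n" for j
      using that by (simp add: binomial_fact field_simps)
    have "i + 1 \<in> {1..<n}" using True by auto
    then have d: "(prob {i + 1} / real (n choose (i + 1)))\<^sup>2
        \<ge> (prob {i} / real (n choose i)) * (prob {i + 2} / real (n choose (i + 2)))"
      using ulc unfolding ULC_def by fastforce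
    have "n - i = m + 2" "n - (i + 1) = m + 1" "n - (i + 2) = m" "i \<le> n" "i + 1 \<le> n" "i + 2 \<le> n"
      using n by auto
    then have "(?b (i + 1) * fact (m + 1) / fact n)\<^sup>2
        \<ge> (?b i * fact (m + 2) / fact n) * (?b (i + 2) * fact m / fact n)"
      using d quot[of i] quot[of "i + 1"] quot[of "i + 2"] by (simp only:)
    then have key: "(?b i * ?b (i + 2)) * (fact (m + 2) * fact m) \<le> (?b (i + 1))\<^sup>2 * (fact (m + 1))\<^sup>2"
      by (simp add: power2_eq_square divide_simps mult_ac split: if_splits)
    have "(fact (m + 1) :: real)\<^sup>2 \<le> fact (m + 2) * fact m"
      by (simp add: power2_eq_square algebra_simps)
    then have "(?b i * ?b (i + 2)) * (fact (m + 1))\<^sup>2 \<le> (?b i * ?b (i + 2)) * (fact (m + 2) * fact m)"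
      by (intro mult_left_mono) auto
    with key have "(?b i * ?b (i + 2)) * (fact (m + 1))\<^sup>2 \<le> (?b (i + 1))\<^sup>2 * (fact (m + 1))\<^sup>2"
      by linarith
    then show ?thesis by (rule mult_right_le_imp_le) simp
  next
    case False
    then show ?thesis using out[of "i + 2"] by simp
  qed
  show ?thesis
  proof (rule log_concave_seqI)
    fix i j k assume "i < j" "j < k" "fact i * prob {i} \<noteq> 0" "fact k * prob {k} \<noteq> 0"
    moreover from this have "k \<le> n" using out[of k] by force
    ultimately show "fact j * prob {j} \<noteq> 0"
      using ulc unfolding ULC_def by (metis fact_nonzero mult_eq_0_iff)
  qed (use local in auto)
qed

text \<open>Half-integers are never atoms of a law on the naturals, so the distribution functions converge
  there, and the mass of a point is a difference of two such values.\<close>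

lemma weak_conv_nat_law_singleton:
  assumes \<nu>: "\<And>k. \<nu> k \<in> nat_laws" and \<mu>: "\<mu> \<in> nat_laws"
    and conv: "weak_conv_m (\<lambda>k. distr (\<nu> k) borel real) (distr \<mu> borel real)"
  shows "(\<lambda>k. measure (\<nu> k) {i}) \<longlonglongrightarrow> measure \<mu> {i}"
proof -
  have meas: "real \<in> measurable \<rho> borel" "prob_space \<rho>" "sets \<rho> = UNIV" if "\<rho> \<in> nat_laws" for \<rho>
  proof -
    show s: "prob_space \<rho>" "sets \<rho> = UNIV" using that by (auto simp: nat_laws_def)
    then have "space \<rho> = UNIV" by (metis UNIV_I sets.sets_into_space top.extremum_uniqueI)
    then show "real \<in> measurable \<rho> borel" using s by (auto simp: measurable_def)
  qed
  have dist: "measure (distr \<rho> borel real) D = measure \<rho> {k. real k \<in> D}"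
    if "\<rho> \<in> nat_laws" "D \<in> sets borel" for \<rho> D
  proof -
    have "space \<rho> = UNIV"
      using meas(3)[OF that(1)] by (metis UNIV_I sets.sets_into_space top.extremum_uniqueI)
    then show ?thesis
      using that meas(1)[OF that(1)] by (simp add: measure_distr vimage_def)
  qed
  have upto: "(\<lambda>k. measure (\<nu> k) {..<j}) \<longlonglongrightarrow> measure \<mu> {..<j}" for j
  proof -
    let ?x = "real j - 1/2"
    have below: "{k. real k \<le> ?x} = {..<j}" by (auto simp: field_simps)
    have none: "{k. real k = ?x} = {}"
    proof -
      have "real k \<noteq> ?x" for k
      proof
        assume "real k = ?x"
        then have "real (2 * k + 1) = real (2 * j)" by simp
        then have "2 * k + 1 = 2 * j" by linarith
        then show False by presburger
      qed
      then show ?thesis by auto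
    qed
    have cdf: "cdf (distr \<rho> borel real) ?x = measure \<rho> {..<j}" if "\<rho> \<in> nat_laws" for \<rho>
      using dist[OF that, of "{..?x}"] below by (simp add: cdf_def)
    interpret D: prob_space "distr \<mu> borel real"
      using meas[OF \<mu>] by (simp add: prob_space.prob_space_distr)
    interpret D: real_distribution "distr \<mu> borel real" by standard auto
    have "isCont (cdf (distr \<mu> borel real)) ?x"
      using dist[OF \<mu>, of "{?x}"] none by (simp add: D.isCont_cdf)
    then have "(\<lambda>k. cdf (distr (\<nu> k) borel real) ?x) \<longlonglongrightarrow> cdf (distr \<mu> borel real) ?x"
      using conv by (simp add: weak_conv_m_def weak_conv_def)
    then show ?thesis by (simp add: cdf \<nu> \<mu>)
  qed
  have single: "measure \<rho> {i} = measure \<rho> {..<Suc i} - measure \<rho> {..<i}" if "\<rho> \<in> nat_laws" for \<rho>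
  proof -
    interpret prob_space \<rho> using meas[OF that] by simp
    show ?thesis
      using finite_measure_Union[of "{..<i}" "{i}"] meas(3)[OF that]
      by (simp add: lessThan_Suc Un_commute)
  qed
  show ?thesis
    using tendsto_diff[OF upto[of "Suc i"] upto[of i]] by (simp add: single \<nu> \<mu>)
qed

lemma class_S_log_concave:
  assumes "\<mu> \<in> class_S"
  shows "log_concave_seq (\<lambda>k. fact k * measure \<mu> {k})"
proof -
  obtain \<nu> where \<nu>: "\<And>k. \<nu> k \<in> (\<Union>n\<in>{1..}. ULC_laws n)"
    and conv: "weak_conv_m (\<lambda>k. distr (\<nu> k) borel real) (distr \<mu> borel real)"
    and \<mu>: "\<mu> \<in> nat_laws"
    using assms by (auto simp: class_S_def)
  have "\<nu> k \<in> nat_laws" for k using \<nu>[of k] by (auto simp: ULC_laws_def)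
  then have "(\<lambda>k. measure (\<nu> k) {i}) \<longlonglongrightarrow> measure \<mu> {i}" for i
    using weak_conv_nat_law_singleton \<mu> conv by blast
  then have lim: "(\<lambda>k. fact i * measure (\<nu> k) {i}) \<longlonglongrightarrow> fact i * measure \<mu> {i}" for i
    by (intro tendsto_mult_left)
  have "log_concave_seq (\<lambda>i. fact i * measure (\<nu> k) {i})" for k
    using \<nu>[of k] ULC_law_log_concave by blast
  then show ?thesis
    using lim by (rule log_concave_seq_limit)
qed

section \<open>Negative correlation under reverse regular weights\<close>

text \<open>A form of Chebyshev's sum inequality. For positive \<open>x\<close> and \<open>y\<close> the last two assumptions say that
  \<open>u / x\<close> and \<open>v / y\<close> are nondecreasing, and the conclusion says that these are negatively correlated
  under the weights \<open>w s t * x s * y t\<close>; without division it also covers zeros of \<open>x\<close> and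
  \<open>y\<close>. The difference \<open>D\<close> of the two sides is a sum over two copies \<open>(s, t)\<close> and \<open>(s', t')\<close>
  of the indices. Symmetrizing it under the exchange of the copies, and then under the exchange of
  \<open>t\<close> and \<open>t'\<close> alone, leaves a sum in which every term has the same sign.\<close>

lemma rr2_sum_mult_le:
  fixes w :: "'a::linorder \<Rightarrow> 'b::linorder \<Rightarrow> real"
  assumes rr2: "\<And>s s' t t'. s \<le> s' \<Longrightarrow> t \<le> t' \<Longrightarrow> w s t * w s' t' \<le> w s t' * w s' t"
    and u: "\<And>s s'. s \<le> s' \<Longrightarrow> u s * x s' \<le> u s' * x s"
    and v: "\<And>t t'. t \<le> t' \<Longrightarrow> v t * y t' \<le> v t' * y t"
  shows "(\<Sum>s\<in>S. \<Sum>t\<in>T. w s t * (u s * v t)) * (\<Sum>s\<in>S. \<Sum>t\<in>T. w s t * (x s * y t))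
    \<le> (\<Sum>s\<in>S. \<Sum>t\<in>T. w s t * (u s * y t)) * (\<Sum>s\<in>S. \<Sum>t\<in>T. w s t * (x s * v t))"
proof -
  define \<phi> where "\<phi> s s' = u s * x s' - u s' * x s" for s s'
  define \<psi> where "\<psi> t t' = v t * y t' - v t' * y t" for t t'
  define Q where "Q h = (\<Sum>s\<in>S. \<Sum>t\<in>T. \<Sum>s'\<in>S. \<Sum>t'\<in>T. h s t s' t')"
    for h :: "'a \<Rightarrow> 'b \<Rightarrow> 'a \<Rightarrow> 'b \<Rightarrow> real"
  have Q_prod: "(\<Sum>s\<in>S. \<Sum>t\<in>T. a s t) * (\<Sum>s\<in>S. \<Sum>t\<in>T. c s t) = Q (\<lambda>s t s' t'. a s t * c s' t')"
    for a c
  proof -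
    have right: "(\<Sum>s\<in>S. \<Sum>t\<in>T. a s t) * r = (\<Sum>s\<in>S. \<Sum>t\<in>T. a s t * r)" for r
      by (simp only: sum_distrib_right)
    show ?thesis unfolding Q_def right by (simp only: sum_distrib_left)
  qed
  have Q_add: "Q h + Q k = Q (\<lambda>s t s' t'. h s t s' t' + k s t s' t')" for h k
    by (simp add: Q_def sum.distrib)
  have Q_diff: "Q h - Q k = Q (\<lambda>s t s' t'. h s t s' t' - k s t s' t')" for h k
    by (simp add: Q_def sum_subtractf)
  have Q_swap: "Q h = Q (\<lambda>s t s' t'. h s' t' s t)" for h
  proof -
    have pair: "(\<Sum>s\<in>S. \<Sum>t\<in>T. r s t) = (\<Sum>a\<in>S \<times> T. r (fst a) (snd a))" for r :: "'a \<Rightarrow> 'b \<Rightarrow> real"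
      by (simp add: sum.cartesian_product split_def)
    have "Q h = (\<Sum>a\<in>S \<times> T. \<Sum>b\<in>S \<times> T. h (fst a) (snd a) (fst b) (snd b))"
      by (simp only: Q_def pair)
    also have "\<dots> = (\<Sum>b\<in>S \<times> T. \<Sum>a\<in>S \<times> T. h (fst a) (snd a) (fst b) (snd b))"
      by (rule sum.swap)
    also have "\<dots> = Q (\<lambda>s t s' t'. h s' t' s t)"
      by (simp only: Q_def pair)
    finally show ?thesis .
  qed
  have Q_swap_right: "Q h = Q (\<lambda>s t s' t'. h s t' s' t)" for h
  proof -
    have flip: "Q h = (\<Sum>s\<in>S. \<Sum>s'\<in>S. \<Sum>t\<in>T. \<Sum>t'\<in>T. h s t s' t')" for h
      unfolding Q_def by (intro sum.cong refl sum.swap)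
    show ?thesis unfolding flip by (intro sum.cong refl sum.swap)
  qed
  define D where "D = Q (\<lambda>s t s' t'. w s t * w s' t' * (u s * x s') * \<psi> t t')"
  have D_eq: "(\<Sum>s\<in>S. \<Sum>t\<in>T. w s t * (u s * v t)) * (\<Sum>s\<in>S. \<Sum>t\<in>T. w s t * (x s * y t))
      - (\<Sum>s\<in>S. \<Sum>t\<in>T. w s t * (u s * y t)) * (\<Sum>s\<in>S. \<Sum>t\<in>T. w s t * (x s * v t)) = D"
    unfolding Q_prod Q_diff D_def \<psi>_def by (simp add: algebra_simps)
  \<comment> \<open>Exchange of the two copies.\<close>
  have "D = Q (\<lambda>s t s' t'. w s' t' * w s t * (u s' * x s) * \<psi> t' t)"
    unfolding D_def by (rule Q_swap)
  then have "D + D = Q (\<lambda>s t s' t'. w s t * w s' t' * (u s * x s') * \<psi> t t')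
      + Q (\<lambda>s t s' t'. w s' t' * w s t * (u s' * x s) * \<psi> t' t)"
    by (simp only: D_def)
  also have "\<dots> = Q (\<lambda>s t s' t'. w s t * w s' t' * \<phi> s s' * \<psi> t t')"
    unfolding Q_add \<phi>_def \<psi>_def by (simp add: algebra_simps)
  finally have once: "D + D = Q (\<lambda>s t s' t'. w s t * w s' t' * \<phi> s s' * \<psi> t t')" .
  \<comment> \<open>Exchange of the second indices only, which reverses the sign of \<open>\<psi>\<close>.\<close>
  also have twice: "\<dots> = Q (\<lambda>s t s' t'. w s t' * w s' t * \<phi> s s' * \<psi> t' t)"
    by (rule Q_swap_right)
  finally have "D + D + (D + D) = Q (\<lambda>s t s' t'. w s t * w s' t' * \<phi> s s' * \<psi> t t')
      + Q (\<lambda>s t s' t'. w s t' * w s' t * \<phi> s s' * \<psi> t' t)"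
    using once by (simp only:)
  also have "\<dots> = Q (\<lambda>s t s' t'. (w s t * w s' t' - w s t' * w s' t) * (\<phi> s s' * \<psi> t t'))"
    unfolding Q_add by (simp add: \<psi>_def algebra_simps)
  also have "\<dots> \<le> 0"
  proof -
    have "(w s t * w s' t' - w s t' * w s' t) * (\<phi> s s' * \<psi> t t') \<le> 0" for s t s' t'
    proof -
      have \<phi>: "\<phi> s s' \<le> 0" if "s \<le> s'" for s s' using u[OF that] by (simp add: \<phi>_def)
      have \<psi>: "\<psi> t t' \<le> 0" if "t \<le> t'" for t t' using v[OF that] by (simp add: \<psi>_def)
      have anti: "\<phi> s s' = - \<phi> s' s" "\<psi> t t' = - \<psi> t' t" by (auto simp: \<phi>_def \<psi>_def)
      consider "s \<le> s'" "t \<le> t'" | "s \<le> s'" "t' \<le> t" | "s' \<le> s" "t \<le> t'" | "s' \<le> s" "t' \<le> t"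
        by fastforce
      then show ?thesis
      proof cases
        case 1
        then show ?thesis using rr2[OF 1] \<phi>[of s s'] \<psi>[of t t']
          by (intro mult_nonpos_nonneg mult_nonpos_nonpos) auto
      next
        case 2
        then show ?thesis using rr2[OF 2] \<phi>[of s s'] \<psi>[of t' t] anti
          by (intro mult_nonneg_nonpos mult_nonpos_nonneg) auto
      next
        case 3
        then show ?thesis using rr2[OF 3] \<phi>[of s' s] \<psi>[of t t'] anti
          by (intro mult_nonneg_nonpos mult_nonneg_nonpos) (auto simp: mult.commute)
      next
        case 4
        then show ?thesis using rr2[OF 4] \<phi>[of s' s] \<psi>[of t' t] anti
          by (intro mult_nonpos_nonneg mult_nonneg_nonneg) (auto simp: mult.commute)
      qed
    qed
    then show ?thesis unfolding Q_def by (intro sum_nonpos)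
  qed
  finally have "D \<le> 0" by simp
  with D_eq show ?thesis by linarith
qed

text \<open>Let each of \<open>\<tau>\<close> points be of the first kind with probability \<open>p\<close> and of the second with
  probability \<open>q\<close>, and let \<open>S\<close> be the number of those of the first kind. For \<open>u s = p ^ s * a s\<close> and
  \<open>v t = q ^ t * b t\<close> this is the expectation of \<open>a S * b (\<tau> - S)\<close> on \<open>\<tau> \<le> K\<close>. Keeping the
  powers inside \<open>u\<close> and \<open>v\<close> avoids a division by \<open>p\<close> or \<open>q\<close>, which may be zero.\<close>

definition binomial_mix :: "(nat \<Rightarrow> real) \<Rightarrow> nat \<Rightarrow> (nat \<Rightarrow> real) \<Rightarrow> (nat \<Rightarrow> real) \<Rightarrow> real" where
  "binomial_mix c K u v = (\<Sum>k\<le>K. c k * (\<Sum>s\<le>k. real (k choose s) * (u s * v (k - s))))"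

text \<open>For positive \<open>p\<close>, the assumption on \<open>u\<close> says that \<open>u s / p ^ s\<close> is nondecreasing. The weights
  \<open>c (s + t) * (s + t choose s)\<close> are \<open>(s + t)! * c (s + t)\<close> up to a factor in \<open>s\<close> and one in
  \<open>t\<close>, so log-concavity makes them reverse regular. The cut-off at \<open>K\<close> preserves this: the largest
  of the four sums of indices occurs on the smaller side.\<close>

lemma binomial_mix_mult_le:
  fixes c :: "nat \<Rightarrow> real"
  assumes lc: "log_concave_seq (\<lambda>k. fact k * c k)"
    and u: "\<And>s. p * u s \<le> u (Suc s)" and v: "\<And>t. q * v t \<le> v (Suc t)"
    and "0 \<le> p" "0 \<le> q"
  shows "binomial_mix c K u v * binomial_mix c K (\<lambda>s. p ^ s) (\<lambda>t. q ^ t)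
    \<le> binomial_mix c K u (\<lambda>t. q ^ t) * binomial_mix c K (\<lambda>s. p ^ s) v"
proof -
  \<comment> \<open>Cutting off the weights instead of the range of summation turns the triangle \<open>s + t \<le> K\<close>
    into a square.\<close>
  define w where "w s t = (if s + t \<le> K then c (s + t) * real (s + t choose s) else 0)" for s t
  have box: "binomial_mix c K f g = (\<Sum>s\<le>K. \<Sum>t\<le>K. w s t * (f s * g t))" for f g
  proof -
    have "binomial_mix c K f g = (\<Sum>(k, s)\<in>(SIGMA k:{..K}. {..k}). w s (k - s) * (f s * g (k - s)))"
      unfolding binomial_mix_def
      by (simp add: sum_distrib_left sum.Sigma) (auto simp: w_def intro!: sum.cong)
    also have "\<dots> = (\<Sum>(s, t)\<in>{(s, t). s + t \<le> K}. w s t * (f s * g t))"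
      by (rule sum.reindex_bij_witness[where i = "\<lambda>(s, t). (s + t, s)" and j = "\<lambda>(k, s). (s, k - s)"])
        auto
    also have "\<dots> = (\<Sum>(s, t)\<in>{..K} \<times> {..K}. w s t * (f s * g t))"
      by (rule sum.mono_neutral_left) (auto simp: w_def split: if_splits)
    finally show ?thesis by (simp add: sum.cartesian_product)
  qed
  have c0: "0 \<le> c k" for k
    using lc by (simp add: log_concave_seq_def zero_le_mult_iff)
      (metis fact_gt_zero linorder_not_less)
  have wfact: "w s t = (fact (s + t) * c (s + t)) / (fact s * fact t)" if "s + t \<le> K" for s t
    using that by (simp add: w_def binomial_fact)
  have w0: "0 \<le> w s t" for s t by (simp add: w_def c0)
  have grow: "h s * r ^ s' \<le> h s' * r ^ s"
    if h: "\<And>s. r * h s \<le> h (Suc s)" and r: "0 \<le> r" and "s \<le> s'" for h :: "nat \<Rightarrow> real" and r s s'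
  proof -
    have "r ^ d * h s \<le> h (s + d)" for d
    proof (induction d)
      case (Suc d)
      have "r ^ Suc d * h s = r * (r ^ d * h s)" by simp
      also have "\<dots> \<le> r * h (s + d)" using Suc r by (intro mult_left_mono)
      also have "\<dots> \<le> h (s + Suc d)" using h[of "s + d"] by simp
      finally show ?case .
    qed simp
    from mult_right_mono[OF this[of "s' - s"], of "r ^ s"] r \<open>s \<le> s'\<close>
    show ?thesis by (simp add: mult_ac flip: power_add)
  qed
  show ?thesis
    unfolding box
  proof (rule rr2_sum_mult_le)
    fix s s' t t' :: nat assume le: "s \<le> s'" "t \<le> t'"
    show "w s t * w s' t' \<le> w s t' * w s' t"
    proof (cases "s' + t' \<le> K")
      case False
      then have "w s' t' = 0" by (simp add: w_def)
      then show ?thesis using w0 by simp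
    next
      case True
      let ?b = "\<lambda>k. fact k * c k"
      have "?b (s + t) * ?b (s + t + (s' - s) + (t' - t))
          \<le> ?b (s + t + (s' - s)) * ?b (s + t + (t' - t))"
        using lc unfolding log_concave_seq_def by blast
      moreover have "s + t + (s' - s) + (t' - t) = s' + t'" "s + t + (s' - s) = s' + t"
        "s + t + (t' - t) = s + t'" using le by auto
      ultimately have "?b (s + t) * ?b (s' + t') \<le> ?b (s + t') * ?b (s' + t)"
        by (simp add: mult.commute)
      then have "?b (s + t) * ?b (s' + t') / (fact s * fact t * fact s' * fact t')
          \<le> ?b (s + t') * ?b (s' + t) / (fact s * fact t * fact s' * fact t')"
        by (intro divide_right_mono) auto
      then show ?thesis using True le by (simp add: wfact mult_ac)
    qed
  qed (use grow[of p u] grow[of q v] assms in auto)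
qed

section \<open>Counts of labels among finitely many sampled points\<close>

definition add_one :: "'i \<Rightarrow> ('i \<Rightarrow> nat) \<Rightarrow> 'i \<Rightarrow> nat" where
  "add_one i N = N(i := Suc (N i))"

text \<open>For \<open>k\<close> independent labels with weights \<open>\<pi>\<close>, the mean of \<open>h\<close>, applied to the counts of the
  labels added to \<open>N\<close>, over the event that all labels lie in \<open>I\<close>. The initial counts \<open>N\<close> are
  a parameter so that the recursion can draw one label at a time.\<close>

primrec count_mean ::
    "'i set \<Rightarrow> ('i \<Rightarrow> real) \<Rightarrow> nat \<Rightarrow> (('i \<Rightarrow> nat) \<Rightarrow> real) \<Rightarrow> ('i \<Rightarrow> nat) \<Rightarrow> real" where
  "count_mean I \<pi> 0 h N = h N"
| "count_mean I \<pi> (Suc k) h N = (\<Sum>i\<in>I. \<pi> i * count_mean I \<pi> k h (add_one i N))"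

lemma count_mean_one: "count_mean I \<pi> k (\<lambda>_. 1) N = (\<Sum>i\<in>I. \<pi> i) ^ k"
  by (induction k arbitrary: N) (simp_all flip: sum_distrib_right)

lemma add_one_commute: "add_one i (add_one j N) = add_one j (add_one i N)"
  by (auto simp: add_one_def fun_eq_iff)

lemma count_mean_add_one_mono:
  assumes "\<And>N. h N \<le> h (add_one i N)" and "\<And>j. j \<in> I \<Longrightarrow> 0 \<le> \<pi> j"
  shows "count_mean I \<pi> k h N \<le> count_mean I \<pi> k h (add_one i N)"
proof (induction k arbitrary: N)
  case (Suc k)
  have "\<pi> j * count_mean I \<pi> k h (add_one j N)
      \<le> \<pi> j * count_mean I \<pi> k h (add_one j (add_one i N))" if "j \<in> I" for j
    unfolding add_one_commute[of j i] using Suc assms(2)[OF that] by (intro mult_left_mono)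
  then show ?case by (auto intro!: sum_mono)
qed (use assms in simp)

text \<open>Raising the initial count at the label drawn first does not decrease the mean of a monotone
  function. After division by the total weight to the power \<open>k\<close>, the mean of \<open>h\<close> is therefore
  nondecreasing in the number of points.\<close>

lemma count_mean_Suc_ge:
  assumes "\<And>i N. i \<in> I \<Longrightarrow> h N \<le> h (add_one i N)" and "\<And>j. j \<in> I \<Longrightarrow> 0 \<le> \<pi> j"
  shows "(\<Sum>i\<in>I. \<pi> i) * count_mean I \<pi> k h N \<le> count_mean I \<pi> (Suc k) h N"
  unfolding sum_distrib_right count_mean.simps
  using assms by (intro sum_mono mult_left_mono count_mean_add_one_mono) auto

lemma count_mean_add_one_eq:
  assumes "\<And>N. h (add_one i N) = h N"
  shows "count_mean I \<pi> k h (add_one i N) = count_mean I \<pi> k h N"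
proof (induction k arbitrary: N)
  case (Suc k)
  show ?case by (simp only: count_mean.simps add_one_commute[of _ i] Suc)
qed (use assms in simp)

lemma sum_binomial_Suc:
  fixes a :: "nat \<Rightarrow> nat \<Rightarrow> real"
  shows "(\<Sum>s\<le>Suc k. real (Suc k choose s) * a s (Suc k - s))
    = (\<Sum>s\<le>k. real (k choose s) * a (Suc s) (k - s)) + (\<Sum>s\<le>k. real (k choose s) * a s (Suc (k - s)))"
proof -
  have "(\<Sum>s\<le>Suc k. real (Suc k choose s) * a s (Suc k - s))
      = a 0 (Suc k) + (\<Sum>s\<le>k. real (Suc k choose Suc s) * a (Suc s) (k - s))"
    by (subst sum.atMost_Suc_shift) simp
  also have "\<dots> = (\<Sum>s\<le>k. real (k choose s) * a (Suc s) (k - s))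
      + (a 0 (Suc k) + (\<Sum>s\<le>k. real (k choose Suc s) * a (Suc s) (k - s)))"
    by (simp add: sum.distrib algebra_simps)
  also have "a 0 (Suc k) + (\<Sum>s\<le>k. real (k choose Suc s) * a (Suc s) (k - s))
      = (\<Sum>s\<le>Suc k. real (k choose s) * a s (Suc k - s))"
    by (subst sum.atMost_Suc_shift) simp
  also have "\<dots> = (\<Sum>s\<le>k. real (k choose s) * a s (Suc (k - s)))"
    by (simp add: Suc_diff_le)
  finally show ?thesis .
qed

text \<open>Among \<open>k\<close> labels, the places of the \<open>s\<close> labels in \<open>A\<close> can be chosen in \<open>k choose s\<close> ways, and each choice
  contributes the same product. In the induction the first label either lies in \<open>A\<close> and changes only
  \<open>f\<close>, or lies in \<open>C\<close> and changes only \<open>g\<close>; Pascal's rule joins the two cases.\<close>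

lemma count_mean_mult:
  assumes fin: "finite A" "finite C" and disj: "A \<inter> C = {}"
    and f: "\<And>i N. i \<in> C \<Longrightarrow> f (add_one i N) = f N"
    and g: "\<And>i N. i \<in> A \<Longrightarrow> g (add_one i N) = g N"
  shows "count_mean (A \<union> C) \<pi> k (\<lambda>N. f N * g N) N
    = (\<Sum>s\<le>k. real (k choose s) * (count_mean A \<pi> s f N * count_mean C \<pi> (k - s) g N))"
proof (induction k arbitrary: N)
  case (Suc k)
  have "count_mean (A \<union> C) \<pi> (Suc k) (\<lambda>N. f N * g N) N
      = (\<Sum>i\<in>A. \<pi> i * (\<Sum>s\<le>k. real (k choose s) *
            (count_mean A \<pi> s f (add_one i N) * count_mean C \<pi> (k - s) g N)))
      + (\<Sum>i\<in>C. \<pi> i * (\<Sum>s\<le>k. real (k choose s) *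
            (count_mean A \<pi> s f N * count_mean C \<pi> (k - s) g (add_one i N))))"
    using fin disj f g by (simp add: sum.union_disjoint Suc count_mean_add_one_eq)
  also have "\<dots> = (\<Sum>s\<le>k. real (k choose s) *
            (count_mean A \<pi> (Suc s) f N * count_mean C \<pi> (k - s) g N))
      + (\<Sum>s\<le>k. real (k choose s) *
            (count_mean A \<pi> s f N * count_mean C \<pi> (Suc (k - s)) g N))"
    by (simp add: sum_distrib_left sum_distrib_right mult_ac sum.swap[of _ "{..k}"])
  also have "\<dots> = (\<Sum>s\<le>Suc k. real (Suc k choose s) *
            (count_mean A \<pi> s f N * count_mean C \<pi> (Suc k - s) g N))"
    by (rule sum_binomial_Suc[symmetric, of k "\<lambda>s t. count_mean A \<pi> s f N * count_mean C \<pi> t g N"])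
  finally show ?case .
qed simp

section \<open>Expectations of functions of the counts\<close>

definition count_labels ::
    "('x \<Rightarrow> 'i) \<Rightarrow> (nat \<Rightarrow> 'w \<Rightarrow> 'x) \<Rightarrow> nat \<Rightarrow> 'w \<Rightarrow> 'i \<Rightarrow> nat" where
  "count_labels lab X j \<omega> i = card {m\<in>{1..j}. lab (X m \<omega>) = i}"

lemma count_labels_0: "count_labels lab X 0 \<omega> = (\<lambda>_. 0)"
  by (simp add: count_labels_def fun_eq_iff)

lemma count_labels_Suc:
  "count_labels lab X (Suc j) \<omega> = add_one (lab (X (Suc j) \<omega>)) (count_labels lab X j \<omega>)"
proof
  fix i
  have "{m \<in> {1..Suc j}. lab (X m \<omega>) = i} = (if lab (X (Suc j) \<omega>) = i
      then insert (Suc j) {m \<in> {1..j}. lab (X m \<omega>) = i} else {m \<in> {1..j}. lab (X m \<omega>) = i})"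
    by (auto simp: le_Suc_eq)
  then show "count_labels lab X (Suc j) \<omega> i
      = (add_one (lab (X (Suc j) \<omega>)) (count_labels lab X j \<omega>)) i"
    by (auto simp: count_labels_def add_one_def)
qed

text \<open>Independence is assumed for an arbitrary event \<open>E\<close>, not only for \<open>\<tau> = k\<close>, because the induction
  removes the last point by intersecting \<open>E\<close> with the event that this point has label \<open>i\<close>. It is
  assumed for every set \<open>J\<close> of points, since both the full intersection and the single last point are
  needed.\<close>

lemma (in prob_space) has_bochner_integral_count_labels:
  fixes X :: "nat \<Rightarrow> 'a \<Rightarrow> 'x::topological_space"
  assumes fin: "finite I" and lab: "\<And>x. lab x \<in> I" "\<And>i. {x. lab x = i} \<in> sets borel"
    and X: "\<And>m. m \<ge> 1 \<Longrightarrow> random_variable borel (X m)"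
    and E: "E \<in> events"
    and indep: "\<And>J D. finite J \<Longrightarrow> J \<subseteq> {1..j} \<Longrightarrow> (\<And>m. m \<in> J \<Longrightarrow> D m \<in> sets borel) \<Longrightarrow>
      prob (E \<inter> {\<omega>\<in>space M. \<forall>m\<in>J. X m \<omega> \<in> D m}) = prob E * (\<Prod>m\<in>J. measure F (D m))"
  shows "has_bochner_integral M (\<lambda>\<omega>. indicator E \<omega> * h (\<lambda>i. N i + count_labels lab X j \<omega> i))
    (prob E * count_mean I (\<lambda>i. measure F {x. lab x = i}) j h N)"
  using E indep
proof (induction j arbitrary: E N)
  case 0
  have "has_bochner_integral M (\<lambda>\<omega>. indicator E \<omega> * h N) (prob E * h N)"
    using 0 has_bochner_integral_real_indicator[of E M]
    by (intro has_bochner_integral_mult_left) (auto simp: emeasure_eq_measure)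
  then show ?case by (simp add: count_labels_0)
next
  case (Suc j)
  let ?E = "\<lambda>i. E \<inter> {\<omega>\<in>space M. X (Suc j) \<omega> \<in> {x. lab x = i}}"
  let ?\<pi> = "\<lambda>i. measure F {x. lab x = i}"
  have ev: "{\<omega>\<in>space M. X (Suc j) \<omega> \<in> D} \<in> events" if "D \<in> sets borel" for D
    using measurable_sets[OF X[of "Suc j"] that] by (simp add: vimage_def Int_def conj_commute)
  have prob_E: "prob (?E i) = prob E * ?\<pi> i" for i
    using Suc.prems(2)[of "{Suc j}" "\<lambda>_. {x. lab x = i}"] lab(2) by simp
  have "has_bochner_integral M
      (\<lambda>\<omega>. indicator (?E i) \<omega> * h (\<lambda>i'. add_one i N i' + count_labels lab X j \<omega> i'))
      (prob (?E i) * count_mean I ?\<pi> j h (add_one i N))" for i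
  proof (rule Suc.IH)
    show "?E i \<in> events" using Suc.prems(1) ev[OF lab(2)] by blast
    fix J and D :: "nat \<Rightarrow> 'x set"
    assume J: "finite J" "J \<subseteq> {1..j}" and D: "\<And>m. m \<in> J \<Longrightarrow> D m \<in> sets borel"
    let ?D = "D(Suc j := {x. lab x = i})"
    have new: "Suc j \<notin> J" using J by auto
    have "?E i \<inter> {\<omega>\<in>space M. \<forall>m\<in>J. X m \<omega> \<in> D m}
        = E \<inter> {\<omega>\<in>space M. \<forall>m\<in>insert (Suc j) J. X m \<omega> \<in> ?D m}"
      using new by (auto split: if_splits)
    also have "prob \<dots> = prob E * (\<Prod>m\<in>insert (Suc j) J. measure F (?D m))"
      using J D lab(2) by (intro Suc.prems(2)) auto
    also have "(\<Prod>m\<in>insert (Suc j) J. measure F (?D m)) = ?\<pi> i * (\<Prod>m\<in>J. measure F (D m))"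
    proof -
      have "(\<Prod>m\<in>J. measure F (?D m)) = (\<Prod>m\<in>J. measure F (D m))"
        using new by (intro prod.cong) auto
      then show ?thesis using J new by simp
    qed
    finally show "prob (?E i \<inter> {\<omega>\<in>space M. \<forall>m\<in>J. X m \<omega> \<in> D m})
        = prob (?E i) * (\<Prod>m\<in>J. measure F (D m))"
      by (simp only: prob_E mult.assoc)
  qed
  then have sum: "has_bochner_integral M
      (\<lambda>\<omega>. \<Sum>i\<in>I. indicator (?E i) \<omega> * h (\<lambda>i'. add_one i N i' + count_labels lab X j \<omega> i'))
      (\<Sum>i\<in>I. prob (?E i) * count_mean I ?\<pi> j h (add_one i N))"
    by (intro has_bochner_integral_sum)
  have "(\<Sum>i\<in>I. indicator (?E i) \<omega> * h (\<lambda>i'. add_one i N i' + count_labels lab X j \<omega> i'))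
      = indicator E \<omega> * h (\<lambda>i. N i + count_labels lab X (Suc j) \<omega> i)" if "\<omega> \<in> space M" for \<omega>
  proof -
    let ?l = "lab (X (Suc j) \<omega>)"
    have "(\<Sum>i\<in>I. indicator (?E i) \<omega> * h (\<lambda>i'. add_one i N i' + count_labels lab X j \<omega> i'))
        = (\<Sum>i\<in>I. if i = ?l then indicator E \<omega> * h (\<lambda>i'. add_one i N i' + count_labels lab X j \<omega> i') else 0)"
      using that by (intro sum.cong) (auto simp: indicator_def)
    also have "\<dots> = indicator E \<omega> * h (\<lambda>i'. add_one ?l N i' + count_labels lab X j \<omega> i')"
      using fin lab(1) by simp
    also have "(\<lambda>i'. add_one ?l N i' + count_labels lab X j \<omega> i')
        = (\<lambda>i. N i + count_labels lab X (Suc j) \<omega> i)"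
      by (auto simp: count_labels_Suc add_one_def)
    finally show ?thesis .
  qed
  then have "has_bochner_integral M (\<lambda>\<omega>. indicator E \<omega> * h (\<lambda>i. N i + count_labels lab X (Suc j) \<omega> i))
      (\<Sum>i\<in>I. prob (?E i) * count_mean I ?\<pi> j h (add_one i N))"
    using sum by (subst (asm) has_bochner_integral_cong[OF refl _ refl])
  also have "(\<Sum>i\<in>I. prob (?E i) * count_mean I ?\<pi> j h (add_one i N))
      = prob E * count_mean I ?\<pi> (Suc j) h N"
    unfolding prob_E by (simp add: sum_distrib_left mult.assoc)
  finally show ?case .
qed

text \<open>The expectation is the limit of those over \<open>\<tau> < K\<close>, dominated by the integrable function itself. On
  \<open>\<tau> = k\<close> only the first \<open>k\<close> points are counted, which reduces the terms to the case of a fixed number of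
  points.\<close>

lemma (in prob_space) count_mean_sums_expectation:
  fixes X :: "nat \<Rightarrow> 'a \<Rightarrow> 'x::topological_space"
  assumes fin: "finite I" and lab: "\<And>x. lab x \<in> I" "\<And>i. {x. lab x = i} \<in> sets borel"
    and X: "\<And>m. m \<ge> 1 \<Longrightarrow> random_variable borel (X m)"
    and \<tau>: "\<And>k. {\<omega>\<in>space M. \<tau> \<omega> = k} \<in> events"
    and indep: "\<And>k J D. finite J \<Longrightarrow> J \<subseteq> {1..} \<Longrightarrow> (\<And>m. m \<in> J \<Longrightarrow> D m \<in> sets borel) \<Longrightarrow>
      prob ({\<omega>\<in>space M. \<tau> \<omega> = k} \<inter> {\<omega>\<in>space M. \<forall>m\<in>J. X m \<omega> \<in> D m})
        = prob {\<omega>\<in>space M. \<tau> \<omega> = k} * (\<Prod>m\<in>J. measure F (D m))"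
    and int: "integrable M (\<lambda>\<omega>. h (count_labels lab X (\<tau> \<omega>) \<omega>))"
  shows "(\<lambda>k. prob {\<omega>\<in>space M. \<tau> \<omega> = k} * count_mean I (\<lambda>i. measure F {x. lab x = i}) k h (\<lambda>_. 0))
    sums expectation (\<lambda>\<omega>. h (count_labels lab X (\<tau> \<omega>) \<omega>))"
proof -
  let ?h = "\<lambda>\<omega>. h (count_labels lab X (\<tau> \<omega>) \<omega>)"
  let ?E = "\<lambda>k. {\<omega>\<in>space M. \<tau> \<omega> = k}"
  let ?e = "\<lambda>k. prob (?E k) * count_mean I (\<lambda>i. measure F {x. lab x = i}) k h (\<lambda>_. 0)"
  have upto: "has_bochner_integral M (\<lambda>\<omega>. indicator {..<K} (\<tau> \<omega>) * ?h \<omega>) (\<Sum>k<K. ?e k)" for K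
  proof -
    have "has_bochner_integral M (\<lambda>\<omega>. indicator (?E k) \<omega> * h (\<lambda>i. 0 + count_labels lab X k \<omega> i)) (?e k)" for k
      by (rule has_bochner_integral_count_labels[OF fin lab X \<tau> indep]) auto
    then have "has_bochner_integral M
        (\<lambda>\<omega>. \<Sum>k<K. indicator (?E k) \<omega> * h (\<lambda>i. 0 + count_labels lab X k \<omega> i)) (\<Sum>k<K. ?e k)"
      by (rule has_bochner_integral_sum)
    moreover have "(\<Sum>k<K. indicator (?E k) \<omega> * h (\<lambda>i. 0 + count_labels lab X k \<omega> i))
        = indicator {..<K} (\<tau> \<omega>) * ?h \<omega>" if "\<omega> \<in> space M" for \<omega>
    proof -
      have "(\<Sum>k<K. indicator (?E k) \<omega> * h (\<lambda>i. 0 + count_labels lab X k \<omega> i))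
          = (\<Sum>k<K. if k = \<tau> \<omega> then ?h \<omega> else 0)"
        using that by (intro sum.cong) auto
      then show ?thesis by (simp add: indicator_def)
    qed
    ultimately show ?thesis
      by (subst (asm) has_bochner_integral_cong[OF refl _ refl])
  qed
  have "(\<lambda>K. expectation (\<lambda>\<omega>. indicator {..<K} (\<tau> \<omega>) * ?h \<omega>)) \<longlonglongrightarrow> expectation ?h"
  proof (rule integral_dominated_convergence[where w = "\<lambda>\<omega>. \<bar>?h \<omega>\<bar>"])
    show "AE \<omega> in M. (\<lambda>K. indicator {..<K} (\<tau> \<omega>) * ?h \<omega>) \<longlonglongrightarrow> ?h \<omega>"
    proof (intro AE_I2 tendsto_eventually)
      show "\<forall>\<^sub>F K in sequentially. indicator {..<K} (\<tau> \<omega>) * ?h \<omega> = ?h \<omega>" for \<omega>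
        using eventually_gt_at_top[of "\<tau> \<omega>"] by eventually_elim simp
    qed
    show "(\<lambda>\<omega>. indicator {..<K} (\<tau> \<omega>) * ?h \<omega>) \<in> borel_measurable M" for K
      using upto[of K] by (auto simp: has_bochner_integral_iff)
  qed (use int in \<open>auto simp: indicator_def\<close>)
  moreover have "expectation (\<lambda>\<omega>. indicator {..<K} (\<tau> \<omega>) * ?h \<omega>) = (\<Sum>k<K. ?e k)" for K
    using upto[of K] by (rule has_bochner_integral_integral_eq)
  ultimately show ?thesis by (simp add: sums_def)
qed

section \<open>Negative association\<close>

lemma measure_sampled_process:
  fixes X :: "nat \<Rightarrow> 'w \<Rightarrow> 'x::topological_space"
  assumes B: "B \<in> sets borel" and lab: "\<And>x. lab x = i \<longleftrightarrow> x \<in> B"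
  shows "measure (sampled_process \<tau> X \<omega>) B = real (count_labels lab X (\<tau> \<omega>) \<omega> i)"
proof -
  have "emeasure (sampled_process \<tau> X \<omega>) B = (\<Sum>m\<in>{1..\<tau> \<omega>}. indicator B (X m \<omega>))"
    using B by (simp add: emeasure_sampled_process)
  also have "\<dots> = (\<Sum>m\<in>{1..\<tau> \<omega>}. if m \<in> {m. lab (X m \<omega>) = i} then 1 else 0)"
    by (intro sum.cong) (auto simp: lab)
  also have "\<dots> = of_nat (count_labels lab X (\<tau> \<omega>) \<omega> i)"
    by (subst sum.If_cases) (simp_all add: count_labels_def Int_def)
  finally show ?thesis by (simp add: measure_def)
qed

lemma (in prob_space) count_labels_measurable:
  fixes X :: "nat \<Rightarrow> 'a \<Rightarrow> 'x::topological_space"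
  assumes lab: "{x. lab x = i} \<in> sets borel"
    and X: "\<And>m. m \<ge> 1 \<Longrightarrow> random_variable borel (X m)"
    and \<tau>: "random_variable (count_space UNIV) \<tau>"
  shows "random_variable borel (\<lambda>\<omega>. real (count_labels lab X (\<tau> \<omega>) \<omega> i))"
proof -
  have "(\<lambda>\<omega>. real (count_labels lab X j \<omega> i)) \<in> borel_measurable M" for j
  proof -
    have eq: "real (count_labels lab X j \<omega> i) = (\<Sum>m\<in>{1..j}. indicator {x. lab x = i} (X m \<omega>))" for \<omega>
      by (simp add: count_labels_def indicator_def sum.If_cases Int_def)
    show ?thesis
      unfolding eq using lab X
      by (intro borel_measurable_sum measurable_compose[OF X borel_measurable_indicator]) auto
  qed
  then show ?thesis using \<tau> by (rule measurable_compose_countable)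
qed

text \<open>Given \<open>\<tau> = k\<close>, the event for the points is a finite-dimensional cylinder for the whole sequence; it
  splits off by independence of \<open>\<tau>\<close> from the sequence, and then factors by independence of the
  points.\<close>

lemma (in prob_space) prob_count_and_points:
  fixes X :: "nat \<Rightarrow> 'a \<Rightarrow> 'x::topological_space"
  assumes iv: "indep_vars (\<lambda>_. borel) X {1..}"
    and id: "\<And>i. i \<ge> 1 \<Longrightarrow> distr M borel (X i) = F"
    and ie: "indep_elements (count_space UNIV) \<tau> (PiM {1..} (\<lambda>_. borel)) (\<lambda>\<omega>. \<lambda>i\<in>{1..}. X i \<omega>)"
    and J: "finite J" "J \<subseteq> {1..}" and D: "\<And>m. m \<in> J \<Longrightarrow> D m \<in> sets borel"
  shows "prob ({\<omega>\<in>space M. \<tau> \<omega> = k} \<inter> {\<omega>\<in>space M. \<forall>m\<in>J. X m \<omega> \<in> D m})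
    = prob {\<omega>\<in>space M. \<tau> \<omega> = k} * (\<Prod>m\<in>J. measure F (D m))"
proof -
  let ?P = "PiM {1..} (\<lambda>_. borel :: 'x measure)" and ?X = "\<lambda>\<omega>. \<lambda>i\<in>{1..}. X i \<omega>"
    and ?T = "{\<omega>\<in>space M. \<tau> \<omega> = k}"
  have X: "random_variable borel (X m)" if "m \<in> J" for m
    using iv J that by (auto simp: indep_vars_def2)
  let ?cyl = "{\<xi>\<in>space ?P. \<forall>m\<in>J. \<xi> m \<in> D m}"
  have "?cyl \<in> sets ?P"
  proof (rule sets.sets_Collect_finite_All)
    fix m assume m: "m \<in> J"
    then have "(\<lambda>\<xi>. \<xi> m) \<in> measurable ?P borel"
      using J by (intro measurable_component_singleton) auto
    from measurable_sets[OF this D[OF m]] show "{\<xi>\<in>space ?P. \<xi> m \<in> D m} \<in> sets ?P"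
      by (simp add: vimage_def Int_def conj_commute)
  qed (use J in auto)
  then have "?X -` ?cyl \<inter> space M \<in> sigma_sets (space M) {?X -` A \<inter> space M | A. A \<in> sets ?P}"
    by blast
  moreover have "?X -` ?cyl \<inter> space M = {\<omega>\<in>space M. \<forall>m\<in>J. X m \<omega> \<in> D m}"
    using J by (auto simp: space_PiM)
  moreover have "?T \<in> sigma_sets (space M) {\<tau> -` A \<inter> space M | A. A \<in> sets (count_space UNIV)}"
  proof -
    have "?T = \<tau> -` {k} \<inter> space M" by auto
    then show ?thesis by auto
  qed
  ultimately have "prob (?T \<inter> {\<omega>\<in>space M. \<forall>m\<in>J. X m \<omega> \<in> D m})
      = prob ?T * prob {\<omega>\<in>space M. \<forall>m\<in>J. X m \<omega> \<in> D m}"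
    using ie unfolding indep_elements_def by (metis (no_types, lifting) indep_setD)
  also have "prob {\<omega>\<in>space M. \<forall>m\<in>J. X m \<omega> \<in> D m} = (\<Prod>m\<in>J. measure F (D m))"
  proof (cases "J = {}")
    case True
    then show ?thesis by (simp add: prob_space)
  next
    case False
    have "{\<omega>\<in>space M. \<forall>m\<in>J. X m \<omega> \<in> D m} = (\<Inter>m\<in>J. X m -` D m \<inter> space M)"
      using False by auto
    also have "prob \<dots> = (\<Prod>m\<in>J. prob (X m -` D m \<inter> space M))"
      by (rule indep_varsD[OF iv False J D])
    also have "\<dots> = (\<Prod>m\<in>J. measure F (D m))"
    proof (rule prod.cong[OF refl])
      fix m assume m: "m \<in> J"
      then have "measure F (D m) = measure (distr M borel (X m)) (D m)"
        using id[of m] J by auto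
      then show "prob (X m -` D m \<inter> space M) = measure F (D m)"
        using measure_distr[OF X[OF m] D[OF m]] by simp
    qed
    finally show ?thesis .
  qed
  finally show ?thesis .
qed

theorem theorem3p6:
  fixes M :: "'w measure"
    and F :: "'x::polish_space measure"
    and X :: "nat \<Rightarrow> 'w \<Rightarrow> 'x"
    and \<tau> :: "'w \<Rightarrow> nat"
  assumes "prob_space M"
    and "prob_space.indep_vars M (\<lambda>_. borel) X {1..}"
    and "\<And>i. i \<ge> 1 \<Longrightarrow> distr M borel (X i) = F"
    and "prob_space.indep_elements M (count_space UNIV) \<tau>
           (PiM {1..} (\<lambda>_. borel)) (\<lambda>\<omega>. \<lambda>i\<in>{1..}. X i \<omega>)"
    and "distr M (count_space UNIV) \<tau> \<in> class_S"
  shows "prob_space.NA_process M (sampled_process \<tau> X)"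
proof -
  interpret prob_space M by fact
  have X: "random_variable borel (X m)" if "m \<ge> 1" for m
    using assms(2) that by (auto simp: indep_vars_def2)
  have \<tau>: "random_variable (count_space UNIV) \<tau>"
    using assms(4) by (simp add: indep_elements_def)
  let ?T = "\<lambda>k. {\<omega>\<in>space M. \<tau> \<omega> = k}"
  have T: "?T k \<in> events" for k
    using measurable_sets[OF \<tau>, of "{k}"] by (simp add: vimage_def Int_def conj_commute)
  define c where "c k = prob (?T k)" for k
  have "measure (distr M (count_space UNIV) \<tau>) {k} = c k" for k
    using \<tau> by (simp add: measure_distr c_def vimage_def Int_def conj_commute)
  then have lc: "log_concave_seq (\<lambda>k. fact k * c k)"
    using class_S_log_concave[OF assms(5)] by simp
  show ?thesis
    unfolding NA_process_def
  proof (intro allI impI, elim conjE)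
    fix n and B :: "nat \<Rightarrow> 'x set"
    assume B: "\<forall>i\<in>{1..n}. B i \<in> sets borel" and disj: "disjoint_family_on B {1..n}"
    \<comment> \<open>Label \<open>0\<close> marks the points outside all the given sets, so that the labels partition the
      space.\<close>
    define lab where "lab x = (if \<exists>i\<in>{1..n}. x \<in> B i then THE i. i \<in> {1..n} \<and> x \<in> B i else 0)" for x
    have lab_in: "lab x = i" if "i \<in> {1..n}" "x \<in> B i" for x i
    proof -
      have "(THE i. i \<in> {1..n} \<and> x \<in> B i) = i"
        using that disj unfolding disjoint_family_on_def by (intro the_equality) blast+
      then show ?thesis using that by (auto simp: lab_def)
    qed
    have lab_out: "lab x = 0" if "\<not> (\<exists>i\<in>{1..n}. x \<in> B i)" for x
      using that by (simp add: lab_def)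
    have lab_iff: "lab x = i \<longleftrightarrow> x \<in> B i" if "i \<in> {1..n}" for x i
    proof
      assume l: "lab x = i"
      with that have nz: "lab x \<noteq> 0" by auto
      have "\<exists>j\<in>{1..n}. x \<in> B j"
        by (rule ccontr) (use lab_out[of x] nz in simp)
      then obtain j where "j \<in> {1..n}" "x \<in> B j" by blast
      then show "x \<in> B i" using l lab_in by blast
    qed (use lab_in that in blast)
    have lab_le: "lab x \<in> {..n}" for x
    proof (cases "\<exists>i\<in>{1..n}. x \<in> B i")
      case True
      then obtain i where "i \<in> {1..n}" "x \<in> B i" by blast
      then show ?thesis using lab_in[of i x] by simp
    qed (simp add: lab_out)
    have lab_meas: "{x. lab x = i} \<in> sets borel" for i
    proof -
      consider "i \<in> {1..n}" | "i = 0" | "i > n" by fastforce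
      then show ?thesis
      proof cases
        case 1
        then show ?thesis using B by (simp add: lab_iff)
      next
        case 2
        have "{x. lab x = i} = UNIV - (\<Union>i\<in>{1..n}. B i)"
          unfolding 2 using lab_in lab_out by fastforce
        then show ?thesis using B by auto
      next
        case 3
        then have "lab x \<noteq> i" for x using lab_le[of x] by auto
        then have "{x. lab x = i} = {}" by simp
        then show ?thesis by simp
      qed
    qed
    define cnt where "cnt \<omega> = count_labels lab X (\<tau> \<omega>) \<omega>" for \<omega>
    have Y: "measure (sampled_process \<tau> X \<omega>) (B i) = real (cnt \<omega> i)" if "i \<in> {1..n}" for \<omega> i
      unfolding cnt_def using B that lab_iff by (intro measure_sampled_process) auto
    define \<pi> where "\<pi> i = measure F {x. lab x = i}" for i
    have lim: "(\<lambda>K. \<Sum>k\<le>K. c k * count_mean {..n} \<pi> k h (\<lambda>_. 0)) \<longlonglongrightarrow> expectation (\<lambda>\<omega>. h (cnt \<omega>))"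
      if "integrable M (\<lambda>\<omega>. h (cnt \<omega>))" for h
    proof -
      have "(\<lambda>k. c k * count_mean {..n} \<pi> k h (\<lambda>_. 0)) sums expectation (\<lambda>\<omega>. h (cnt \<omega>))"
        unfolding c_def \<pi>_def cnt_def
        using that prob_count_and_points[OF assms(2,3,4)]
        by (intro count_mean_sums_expectation lab_le lab_meas X T) (auto simp: cnt_def)
      then show ?thesis by (simp add: sums_def_le)
    qed
    show "NA_vector n (\<lambda>i \<omega>. measure (sampled_process \<tau> X \<omega>) (B i))"
      unfolding NA_vector_def
    proof (intro conjI ballI allI impI)
      show "random_variable borel (\<lambda>\<omega>. measure (sampled_process \<tau> X \<omega>) (B i))" if "i \<in> {1..n}" for i
        unfolding Y[OF that] cnt_def by (intro count_labels_measurable lab_meas X \<tau>)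
      fix A and f g :: "(nat \<Rightarrow> real) \<Rightarrow> real"
      assume A: "A \<subseteq> {1..n}"
        and f: "mono_on (A \<rightarrow>\<^sub>E UNIV) f" and g: "mono_on (({1..n} - A) \<rightarrow>\<^sub>E UNIV) g"
      let ?U = "\<lambda>\<omega>. f (\<lambda>i\<in>A. measure (sampled_process \<tau> X \<omega>) (B i))"
      let ?V = "\<lambda>\<omega>. g (\<lambda>j\<in>{1..n} - A. measure (sampled_process \<tau> X \<omega>) (B j))"
      assume ex: "covariance_exists ?U ?V"
      define f' where "f' N = f (\<lambda>i\<in>A. real (N i))" for N :: "nat \<Rightarrow> nat"
      define g' where "g' N = g (\<lambda>i\<in>{1..n} - A. real (N i))" for N :: "nat \<Rightarrow> nat"
      have U: "?U = (\<lambda>\<omega>. f' (cnt \<omega>))"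
        unfolding f'_def using A Y by (intro ext arg_cong[where f = f] restrict_ext) auto
      have V: "?V = (\<lambda>\<omega>. g' (cnt \<omega>))"
        unfolding g'_def using Y by (intro ext arg_cong[where f = g] restrict_ext) auto
      \<comment> \<open>Label \<open>0\<close> influences neither function; it is counted with the labels seen by \<open>g\<close>.\<close>
      let ?C = "{..n} - A"
      have union: "A \<union> {..n} = {..n}" using A by auto
      have fin: "finite A" "finite ?C" using A finite_subset by auto
      have f'_eq: "f' (add_one i N) = f' N" if "i \<in> ?C" for i N
        unfolding f'_def add_one_def using that by (intro arg_cong[where f = f] restrict_ext) auto
      have g'_eq: "g' (add_one i N) = g' N" if "i \<in> A" for i N
        unfolding g'_def add_one_def using that by (intro arg_cong[where f = g] restrict_ext) auto
      have f'_mono: "f' N \<le> f' (add_one i N)" for i N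
        unfolding f'_def by (rule mono_onD[OF f]) (auto simp: le_fun_def add_one_def)
      have g'_mono: "g' N \<le> g' (add_one i N)" for i N
        unfolding g'_def by (rule mono_onD[OF g]) (auto simp: le_fun_def add_one_def)
      define p where "p = (\<Sum>i\<in>A. \<pi> i)"
      define q where "q = (\<Sum>i\<in>?C. \<pi> i)"
      define u where "u = (\<lambda>s. count_mean A \<pi> s f' (\<lambda>_. 0))"
      define v where "v = (\<lambda>t. count_mean ?C \<pi> t g' (\<lambda>_. 0))"
      have \<pi>0: "0 \<le> \<pi> i" for i by (simp add: \<pi>_def)
      have mix: "(\<Sum>k\<le>K. c k * count_mean {..n} \<pi> k (\<lambda>N. h N * h' N) (\<lambda>_. 0))
          = binomial_mix c K (\<lambda>s. count_mean A \<pi> s h (\<lambda>_. 0)) (\<lambda>t. count_mean ?C \<pi> t h' (\<lambda>_. 0))"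
        if "\<And>i N. i \<in> ?C \<Longrightarrow> h (add_one i N) = h N" "\<And>i N. i \<in> A \<Longrightarrow> h' (add_one i N) = h' N"
        for h h' K
        using count_mean_mult[where f = h and g = h', OF fin _ that] by (simp add: binomial_mix_def union)
      have int: "integrable M (\<lambda>\<omega>. f' (cnt \<omega>))" "integrable M (\<lambda>\<omega>. g' (cnt \<omega>))"
        "integrable M (\<lambda>\<omega>. f' (cnt \<omega>) * g' (cnt \<omega>))"
        using ex unfolding covariance_exists_def U V by auto
      \<comment> \<open>The four limits come from one formula, with a constant function in place of \<open>f'\<close> or
        \<open>g'\<close>.\<close>
      have lim_fg: "(\<lambda>K. binomial_mix c K u v) \<longlonglongrightarrow> expectation (\<lambda>\<omega>. f' (cnt \<omega>) * g' (cnt \<omega>))"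
        using lim[of "\<lambda>N. f' N * g' N"] int mix[of f' g'] f'_eq g'_eq by (simp add: u_def v_def)
      have lim_f: "(\<lambda>K. binomial_mix c K u (\<lambda>t. q ^ t)) \<longlonglongrightarrow> expectation (\<lambda>\<omega>. f' (cnt \<omega>))"
        using lim[of f'] int mix[of f' "\<lambda>_. 1"] f'_eq by (simp add: u_def q_def count_mean_one)
      have lim_g: "(\<lambda>K. binomial_mix c K (\<lambda>s. p ^ s) v) \<longlonglongrightarrow> expectation (\<lambda>\<omega>. g' (cnt \<omega>))"
        using lim[of g'] int mix[of "\<lambda>_. 1" g'] g'_eq by (simp add: v_def p_def count_mean_one)
      have lim_1: "(\<lambda>K. binomial_mix c K (\<lambda>s. p ^ s) (\<lambda>t. q ^ t)) \<longlonglongrightarrow> 1"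
        using lim[of "\<lambda>_. 1"] mix[of "\<lambda>_. 1" "\<lambda>_. 1"]
        by (simp add: p_def q_def count_mean_one prob_space)
      have "binomial_mix c K u v * binomial_mix c K (\<lambda>s. p ^ s) (\<lambda>t. q ^ t)
          \<le> binomial_mix c K u (\<lambda>t. q ^ t) * binomial_mix c K (\<lambda>s. p ^ s) v" for K
      proof (rule binomial_mix_mult_le[OF lc])
        show "p * u s \<le> u (Suc s)" for s
          unfolding p_def u_def by (intro count_mean_Suc_ge f'_mono \<pi>0)
        show "q * v t \<le> v (Suc t)" for t
          unfolding q_def v_def by (intro count_mean_Suc_ge g'_mono \<pi>0)
      qed (auto simp: p_def q_def intro: sum_nonneg \<pi>0)
      then have "expectation (\<lambda>\<omega>. f' (cnt \<omega>) * g' (cnt \<omega>)) * 1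
          \<le> expectation (\<lambda>\<omega>. f' (cnt \<omega>)) * expectation (\<lambda>\<omega>. g' (cnt \<omega>))"
        by (intro LIMSEQ_le[OF tendsto_mult[OF lim_fg lim_1] tendsto_mult[OF lim_f lim_g]]) auto
      moreover have "covariance ?U ?V = expectation (\<lambda>\<omega>. f' (cnt \<omega>) * g' (cnt \<omega>))
          - expectation (\<lambda>\<omega>. f' (cnt \<omega>)) * expectation (\<lambda>\<omega>. g' (cnt \<omega>))"
        unfolding covariance_def U V
        using int by (simp add: left_diff_distrib right_diff_distrib prob_space)
      ultimately show "covariance ?U ?V \<le> 0" by simp
    qed
  qed
qed

end
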